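(* Let $\lambda$ be an uncountable cardinal, $\mathbb{B}$ a complete Boolean algebra, and $U$ an ultrafilter on $\mathbb{B}$. Then $U$ is $\lambda$-Benda if and only if $U$ is $\aleph_1$-incomplete and $\lambda$-good.
   Context: $[\kappa]^{<\omega}$ denotes the set of finite subsets of a cardinal $\kappa$. A function $f\colon[\kappa]^{<\omega}\to\mathbb{B}$ is monotonic if $S\subseteq T$ implies $f(T)\le f(S)$; it is multiplicative if $f(S\cup T)=f(S)\wedge f(T)$ for all $S,T$. An antichain in $\mathbb{B}$ is a set $A\subseteq\mathbb{B}\setminus\{\mathbb{0}\}$ of pairwise disjoint elements (for $a,b\in A$, $a\wedge b>\mathbb{0}$ implies $a=b$); maximal antichains are those maximal under inclusion. For finitely many maximal antichains $A_0,\dots,A_{n-1}$, $\bigwedge_{i<n}A_i=\{a_0\wedge\dots\wedge a_{n-1} : a_i\in A_i\}\setminus\{\mathbb{0}\}$ (a maximal antichain; for $n=0$ it is $\{\mathbb{1}\}$); for a maximal antichain $A$ and a family $\{A_\alpha\}$, $A\wedge\bigwedge_{\alpha\in S}A_\alpha$ is defined likewise. An element $x$ is based on a maximal antichain $A$ if for every $a\in A$ either $a\le x$ or $a\wedge x=\mathbb{0}$. $U$ is $\aleph_1$-incomplete if it is not $\aleph_1$-complete, i.e. there is a countable subset of $U$ whose meet is not in $U$. $U$ is $\lambda$-good (Mansfield) if for every cardinal $\kappa<\lambda$ and every monotonic $f\colon[\kappa]^{<\omega}\to U$ there is a multiplicative $g\colon[\kappa]^{<\omega}\to U$ with $g(S)\le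 f(S)$ for all finite $S\subseteq\kappa$. $U$ is $\lambda$-Benda if for every cardinal $\kappa<\lambda$, every function $f\colon[\kappa]^{<\omega}\to U$ and every family of maximal antichains $\{A_\alpha:\alpha<\kappa\}$ such that $f(S)$ is based on $\bigwedge_{\alpha\in S}A_\alpha$ for all finite $S\subseteq\kappa$, there exist a multiplicative $g\colon[\kappa]^{<\omega}\to U$ and a maximal antichain $A$ such that: (i) for all finite $S$, $g(S)$ is based on $A\wedge\bigwedge_{\alpha\in S}A_\alpha$; (ii) for all $a\in A$, the set $\{\alpha<\kappa : a\wedge g(\{\alpha\})>\mathbb{0}\}$ is finite; (iii) $g(S)\le f(S)$ for all finite $S$. *)

theory Defs
  imports "HOL-Library.FuncSet" "HOL-Library.Countable_Set"
begin

unbundle cardinal_syntax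

text \<open>
  Complete Boolean algebras are types of sort \<open>{boolean_algebra, complete_lattice}\<close>. The library
  class \<open>complete_boolean_algebra\<close> is not used, because it demands complete distributivity and hence
  only covers the atomic complete Boolean algebras.

  A cardinal is a relation \<open>k\<close> with \<open>Card_order k\<close>; its elements form \<open>Field k\<close>, and the set
  of finite subsets of \<open>k\<close> is \<open>Fpow (Field k)\<close>. Every cardinal below \<open>lam :: 'l rel\<close> has a
  representative of the same type \<open>'l rel\<close>, so quantifying over \<open>k :: 'l rel\<close> with \<open>k <o lam\<close>
  covers all of them. Functions and families indexed by a cardinal are only constrained on
  \<open>Fpow (Field k)\<close> and \<open>Field k\<close>, respectively.
\<close>

definition ultrafilter :: "'b::boolean_algebra set \<Rightarrow> bool" where
  "ultrafilter U \<longleftrightarrow>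
     top \<in> U \<and> bot \<notin> U \<and>
     (\<forall>x\<in>U. \<forall>y\<in>U. inf x y \<in> U) \<and>
     (\<forall>x\<in>U. \<forall>y. x \<le> y \<longrightarrow> y \<in> U) \<and>
     (\<forall>x. x \<in> U \<or> - x \<in> U)"

definition aleph1_incomplete :: "'b::complete_lattice set \<Rightarrow> bool" where
  "aleph1_incomplete U \<longleftrightarrow> (\<exists>X\<subseteq>U. countable X \<and> Inf X \<notin> U)"

definition monotonic :: "'l rel \<Rightarrow> ('l set \<Rightarrow> 'b::order) \<Rightarrow> bool" where
  "monotonic k f \<longleftrightarrow> (\<forall>S\<in>Fpow (Field k). \<forall>T\<in>Fpow (Field k). S \<subseteq> T \<longrightarrow> f T \<le> f S)"

definition multiplicative :: "'l rel \<Rightarrow> ('l set \<Rightarrow> 'b::semilattice_inf) \<Rightarrow> bool" where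
  "multiplicative k f \<longleftrightarrow>
     (\<forall>S\<in>Fpow (Field k). \<forall>T\<in>Fpow (Field k). f (S \<union> T) = inf (f S) (f T))"

definition antichain :: "'b::bounded_lattice set \<Rightarrow> bool" where
  "antichain A \<longleftrightarrow> bot \<notin> A \<and> (\<forall>a\<in>A. \<forall>b\<in>A. inf a b \<noteq> bot \<longrightarrow> a = b)"

definition maximal_antichain :: "'b::bounded_lattice set \<Rightarrow> bool" where
  "maximal_antichain A \<longleftrightarrow> antichain A \<and> (\<forall>A'. antichain A' \<and> A \<subseteq> A' \<longrightarrow> A' = A)"

definition based_on :: "'b::bounded_lattice \<Rightarrow> 'b set \<Rightarrow> bool" where
  "based_on x A \<longleftrightarrow> (\<forall>a\<in>A. a \<le> x \<or> inf a x = bot)"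

definition meet_antichains :: "'l set \<Rightarrow> ('l \<Rightarrow> 'b::complete_lattice set) \<Rightarrow> 'b set" where
  "meet_antichains S A = {(INF i\<in>S. a i) | a. \<forall>i\<in>S. a i \<in> A i} - {bot}"

definition meet_antichain :: "'b::bounded_lattice set \<Rightarrow> 'b set \<Rightarrow> 'b set" where
  "meet_antichain A B = {inf a b | a b. a \<in> A \<and> b \<in> B} - {bot}"

definition good :: "'l rel \<Rightarrow> 'b::{boolean_algebra,complete_lattice} set \<Rightarrow> bool" where
  "good lam U \<longleftrightarrow>
     (\<forall>(k :: 'l rel) f. Card_order k \<and> k <o lam \<and> f \<in> Fpow (Field k) \<rightarrow> U \<and> monotonic k f \<longrightarrow>
        (\<exists>g. g \<in> Fpow (Field k) \<rightarrow> U \<and> multiplicative k g \<and>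
             (\<forall>S\<in>Fpow (Field k). g S \<le> f S)))"

definition benda :: "'l rel \<Rightarrow> 'b::{boolean_algebra,complete_lattice} set \<Rightarrow> bool" where
  "benda lam U \<longleftrightarrow>
     (\<forall>(k :: 'l rel) f (A :: 'l \<Rightarrow> 'b set).
        Card_order k \<and> k <o lam \<and> f \<in> Fpow (Field k) \<rightarrow> U \<and>
        (\<forall>i\<in>Field k. maximal_antichain (A i)) \<and>
        (\<forall>S\<in>Fpow (Field k). based_on (f S) (meet_antichains S A)) \<longrightarrow>
        (\<exists>g B. g \<in> Fpow (Field k) \<rightarrow> U \<and> multiplicative k g \<and> maximal_antichain B \<and>
           (\<forall>S\<in>Fpow (Field k). based_on (g S) (meet_antichain B (meet_antichains S A))) \<and>
           (\<forall>b\<in>B. finite {i \<in> Field k. inf b (g {i}) \<noteq> bot}) \<and>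
           (\<forall>S\<in>Fpow (Field k). g S \<le> f S)))"

end

theory Submission
  imports Defs
begin

text \<open>
  Suppose \<open>U\<close> is incomplete and good. Meeting \<open>f(S)\<close> with the \<open>|S|\<close>-th member of a decreasing
  sequence in \<open>U\<close> with meet \<open>\<zero>\<close> before applying goodness yields a multiplicative \<open>g\<close> such that below
  densely many \<open>c\<close> the sizes of the \<open>S\<close> with \<open>c \<and> g(S) > \<zero>\<close> are bounded. If \<open>S\<close> has maximal size,
  then \<open>c \<and> g(S)\<close> decides every value of \<open>g\<close>, so a single maximal antichain decides all of \<open>g\<close>.

  Conversely, the Benda property of the constant function \<open>\<one>\<close> yields locally finite elements
  \<open>h(i) \<in> U\<close>, which give incompleteness for countably many \<open>i\<close>. Given \<open>f\<close>, the function
  \<open>S \<mapsto> f(S) \<and> (\<And>i\<in>S. h(i))\<close> has locally only finitely many nonzero values, so it is based on a single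
  maximal antichain, and a second application of the Benda property gives \<open>g\<close>.
\<close>

section \<open>Ultrafilters, maximal antichains and elements based on them\<close>

lemma ultrafilter_Inf_finite:
  fixes U :: "'b::{boolean_algebra,complete_lattice} set"
  assumes "ultrafilter U" "finite X" "X \<subseteq> U"
  shows "Inf X \<in> U"
  using assms(2,3)
proof induction
  case empty
  then show ?case using assms(1) by (simp add: ultrafilter_def)
next
  case (insert x X)
  then show ?case using assms(1) by (simp add: ultrafilter_def)
qed

lemma ultrafilter_top_neq_bot:
  fixes U :: "'b::boolean_algebra set"
  assumes "ultrafilter U"
  shows "(top::'b) \<noteq> bot" and "top \<in> U"
  using assms unfolding ultrafilter_def by metis+

lemma maximal_antichain_meets:
  assumes "maximal_antichain B" "c \<noteq> bot"
  obtains b where "b \<in> B" "inf c b \<noteq> bot"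
proof (rule ccontr)
  assume "\<not> thesis"
  then have disj: "\<forall>b\<in>B. inf c b = bot" using that by blast
  have "antichain (insert c B)"
    using assms disj unfolding maximal_antichain_def antichain_def
    by (auto simp: inf_commute)
  then have "c \<in> B"
    using assms(1) unfolding maximal_antichain_def by (metis insertI1 subset_insertI)
  with disj assms(2) show False by auto
qed

lemma maximal_antichain_top:
  assumes "(top::'b::bounded_lattice) \<noteq> bot"
  shows "maximal_antichain {top::'b}"
  unfolding maximal_antichain_def
proof (intro conjI allI impI)
  show "antichain {top::'b}" using assms by (simp add: antichain_def)
  fix A :: "'b set" assume A: "antichain A \<and> {top} \<subseteq> A"
  have "a = top" if "a \<in> A" for a
  proof -
    have "inf a top \<noteq> bot" using A that by (auto simp: antichain_def)
    with A that show ?thesis unfolding antichain_def by blast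
  qed
  with A show "A = {top}" by blast
qed

text \<open>Turns a property of densely many elements into a single antichain of elements with that
  property. Zorn's lemma gives \<open>M\<close> maximal among the antichains inside
  \<open>D\<close>. It is maximal outright: a new member \<open>a\<close> of a larger antichain
  would have a nonzero element of \<open>D\<close> below it, which could be added to
  \<open>M\<close>.\<close>

lemma maximal_antichain_in_dense:
  fixes D :: "'b::bounded_lattice set"
  assumes dense: "\<And>c. c \<noteq> bot \<Longrightarrow> \<exists>d\<in>D. d \<noteq> bot \<and> d \<le> c"
  obtains B where "maximal_antichain B" "B \<subseteq> D"
proof -
  let ?\<A> = "{A. antichain A \<and> A \<subseteq> D}"
  have "\<exists>M\<in>?\<A>. \<forall>X\<in>?\<A>. M \<subseteq> X \<longrightarrow> X = M"
  proof (rule subset_Zorn')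
    fix C assume C: "subset.chain ?\<A> C"
    have "a = b" if "a \<in> \<Union>C" "b \<in> \<Union>C" "inf a b \<noteq> bot" for a b
    proof -
      from that obtain X Y where XY: "X \<in> C" "Y \<in> C" "a \<in> X" "b \<in> Y" by auto
      with C have "X \<subseteq> Y \<or> Y \<subseteq> X" unfolding subset_chain_def by blast
      with XY obtain Z where "Z \<in> C" "a \<in> Z" "b \<in> Z" by blast
      with C that show ?thesis unfolding subset_chain_def antichain_def by blast
    qed
    moreover have "bot \<notin> \<Union>C" "\<Union>C \<subseteq> D"
      using C unfolding subset_chain_def antichain_def by blast+
    ultimately show "\<Union>C \<in> ?\<A>" by (simp add: antichain_def)
  qed
  then obtain M where M: "antichain M" "M \<subseteq> D"
    and "\<forall>X\<in>?\<A>. M \<subseteq> X \<longrightarrow> X = M" by (elim bexE CollectE conjE)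
  then have max: "X = M" if "antichain X" "X \<subseteq> D" "M \<subseteq> X" for X
    using that by simp
  have "maximal_antichain M"
    unfolding maximal_antichain_def
  proof (intro conjI allI impI)
    fix A assume A: "antichain A \<and> M \<subseteq> A"
    show "A = M"
    proof (rule ccontr)
      assume "A \<noteq> M"
      with A obtain a where a: "a \<in> A" "a \<notin> M" by blast
      with A have "a \<noteq> bot" by (auto simp: antichain_def)
      with dense obtain d where d: "d \<in> D" "d \<noteq> bot" "d \<le> a" by blast
      have disj: "inf d m = bot" if "m \<in> M" for m
      proof -
        have "inf a m = bot" using A a that unfolding antichain_def by blast
        with d(3) show ?thesis by (metis bot.extremum_uniqueI inf_mono order_refl)
      qed
      have "antichain (insert d M)"
        using M(1) d disj unfolding antichain_def by (auto simp: inf_commute)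
      then have "insert d M = M" using max M d by blast
      with disj d(2) show False by (metis inf.idem insertI1)
    qed
  qed (rule M)
  with M that show thesis by blast
qed

lemma decided_below:
  fixes b :: "'b::bounded_lattice"
  assumes "b \<le> a" "a \<le> x \<or> inf a x = bot"
  shows "b \<le> x \<or> inf b x = bot"
proof -
  have "inf b x \<le> inf a x" using assms(1) by (rule inf_mono) simp
  with assms show ?thesis by (metis bot.extremum_unique order_trans)
qed

lemma based_on_refine:
  assumes "based_on x A" "\<And>b. b \<in> B \<Longrightarrow> \<exists>a\<in>A. b \<le> a"
  shows "based_on x B"
  unfolding based_on_def
proof
  fix b assume "b \<in> B"
  with assms obtain a where "b \<le> a" "a \<le> x \<or> inf a x = bot"
    unfolding based_on_def by blast
  then show "b \<le> x \<or> inf b x = bot"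
    by (rule decided_below)
qed

lemma based_on_meet_antichain:
  "based_on x A \<Longrightarrow> based_on x (meet_antichain A B)"
  by (erule based_on_refine) (auto simp: meet_antichain_def intro: inf_le1)

text \<open>Any one factor of a meet over \<open>S\<close> is a member of \<open>C\<close> above it,
  so the meets refine \<open>C\<close>. For empty \<open>S\<close> there is no factor: the only meet
  is \<open>top\<close>, on which just \<open>top\<close> and \<open>bot\<close> are based.\<close>

lemma based_on_meet_antichains_const:
  fixes C :: "'b::complete_lattice set"
  assumes "based_on x C" "S \<noteq> {}"
  shows "based_on x (meet_antichains S (\<lambda>_. C))"
proof (rule based_on_refine[OF assms(1)])
  fix b assume "b \<in> meet_antichains S (\<lambda>_. C)"
  then obtain a where "b = (INF i\<in>S. a i)" "\<forall>i\<in>S. a i \<in> C"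
    by (auto simp: meet_antichains_def)
  with assms(2) show "\<exists>a\<in>C. b \<le> a" by (metis INF_lower ex_in_conv)
qed

text \<open>Treat the members of \<open>Y\<close> one by one, shrinking \<open>d\<close> to
  \<open>inf d y\<close> whenever this is nonzero. Decisions already made survive below, by
  \<open>decided_below\<close>.\<close>

lemma finite_decide:
  fixes c :: "'b::bounded_lattice"
  assumes "finite Y" "c \<noteq> bot"
  shows "\<exists>d\<le>c. d \<noteq> bot \<and> (\<forall>y\<in>Y. d \<le> y \<or> inf d y = bot)"
  using assms
proof (induction Y)
  case empty
  then show ?case by auto
next
  case (insert y Y)
  then obtain d where d: "d \<le> c" "d \<noteq> bot" "\<forall>y\<in>Y. d \<le> y \<or> inf d y = bot" by blast
  show ?case
  proof (cases "inf d y = bot")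
    case True
    with d show ?thesis by blast
  next
    case False
    have "inf d y \<le> z \<or> inf (inf d y) z = bot" if "z \<in> Y" for z
      using d(3) that by (intro decided_below[OF inf_le1]) blast
    with False d(1) show ?thesis
      by (intro exI[of _ "inf d y"]) (auto intro: le_infI1)
  qed
qed

section \<open>From incompleteness and goodness to the Benda property\<close>

lemma aleph1_incomplete_decreasing:
  fixes U :: "'b::{boolean_algebra,complete_lattice} set"
  assumes "ultrafilter U" "aleph1_incomplete U"
  obtains x :: "nat \<Rightarrow> 'b"
  where "range x \<subseteq> U" "antimono x" "(INF n. x n) = bot"
proof -
  from assms(2) obtain X where X: "X \<subseteq> U" "countable X" "Inf X \<notin> U"
    unfolding aleph1_incomplete_def by blast
  have ne: "X \<noteq> {}" using X(3) assms(1) by (auto simp: ultrafilter_def)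
  \<comment> \<open>\<open>Inf X\<close> may be nonzero, so the finite partial meets alone need not
    have meet \<open>bot\<close>. The factor \<open>- Inf X\<close>, which lies in \<open>U\<close>,
    removes the remainder.\<close>
  define x where "x n = inf (- Inf X) (INF m\<in>{..n}. from_nat_into X m)" for n :: nat
  show thesis
  proof
    have "(INF m\<in>{..n}. from_nat_into X m) \<in> U" for n
      using from_nat_into[OF ne] X(1) by (intro ultrafilter_Inf_finite[OF assms(1)]) auto
    moreover have "- Inf X \<in> U" using assms(1) X(3) by (auto simp: ultrafilter_def)
    ultimately show "range x \<subseteq> U" using assms(1) by (auto simp: ultrafilter_def x_def)
    show "antimono x"
      unfolding x_def by (intro antimonoI inf_mono order_refl INF_superset_mono) auto
    have "(INF n. x n) \<le> y" if y: "y \<in> X" for y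
    proof -
      obtain n where n: "from_nat_into X n = y"
        using from_nat_into_surj[OF X(2) y] ..
      have "(INF n. x n) \<le> x n" by (simp add: INF_lower)
      also have "x n \<le> y" unfolding x_def n[symmetric] by (intro le_infI2 INF_lower) simp
      finally show ?thesis .
    qed
    then have "(INF n. x n) \<le> Inf X" by (rule Inf_greatest)
    moreover have "(INF n. x n) \<le> x 0" by (simp add: INF_lower)
    then have "(INF n. x n) \<le> - Inf X" by (simp add: x_def)
    ultimately have "(INF n. x n) \<le> inf (Inf X) (- Inf X)" by (rule le_infI)
    then show "(INF n. x n) = bot" by (simp add: bot.extremum_unique)
  qed
qed

lemma multiplicative_mono:
  assumes "multiplicative k g" "S \<in> Fpow (Field k)" "T \<in> Fpow (Field k)" "S \<subseteq> T"
  shows "g T \<le> g S"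
  using assms unfolding multiplicative_def by (metis Un_absorb1 inf_le1)

lemma multiplicative_based_on_antichain:
  fixes x :: "nat \<Rightarrow> 'b::{boolean_algebra,complete_lattice}"
  assumes g: "multiplicative k g"
    and x: "antimono x" "(INF n. x n) = bot"
    and gx: "\<And>S. S \<in> Fpow (Field k) \<Longrightarrow> g S \<le> x (card S)"
  obtains B where "maximal_antichain B"
    "\<And>S. S \<in> Fpow (Field k) \<Longrightarrow> based_on (g S) B"
    "\<And>b. b \<in> B \<Longrightarrow> finite {i \<in> Field k. inf b (g {i}) \<noteq> bot}"
proof -
  define D where "D = {c. (\<forall>S\<in>Fpow (Field k). c \<le> g S \<or> inf c (g S) = bot) \<and>
                          finite {i \<in> Field k. inf c (g {i}) \<noteq> bot}}"
  have "\<exists>d\<in>D. d \<noteq> bot \<and> d \<le> c" if "c \<noteq> bot" for c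
  proof -
    from x(2) that obtain n where "\<not> c \<le> x n"
      by (metis INF_greatest bot.extremum_uniqueI)
    \<comment> \<open>\<open>c1\<close> is disjoint from \<open>x n\<close>, hence from
      \<open>g S\<close> for every \<open>S\<close> with at least \<open>n\<close> elements.\<close>
    define c1 where "c1 = inf c (- x n)"
    have c1: "c1 \<noteq> bot" "c1 \<le> c" "c1 \<le> - x n"
      using \<open>\<not> c \<le> x n\<close> by (auto simp: c1_def inf_shunt)
    define P where "P S \<longleftrightarrow> S \<in> Fpow (Field k) \<and> inf c1 (g S) \<noteq> bot" for S
    have bound: "card S < n" if "P S" for S
    proof (rule ccontr)
      assume "\<not> card S < n"
      then have "x (card S) \<le> x n" using x(1) by (simp add: antimonoD)
      then have "g S \<le> x n" using gx that P_def order_trans by blast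
      then have "inf c1 (g S) \<le> inf (- x n) (x n)" using c1(3) by (rule inf_mono[rotated])
      with that show False by (simp add: P_def bot.extremum_unique)
    qed
    show ?thesis
    proof (cases "\<exists>S. P S")
      \<comment> \<open>This case can occur because \<open>g {}\<close> need not be
        \<open>top\<close>: then \<open>c1\<close> is disjoint from all values of \<open>g\<close>
        and decides them already.\<close>
      case False
      have zero: "inf c1 (g S) = bot" if "S \<in> Fpow (Field k)" for S using False that P_def by blast
      have "inf c1 (g {i}) = bot" if "i \<in> Field k" for i
        using that by (intro zero) (simp add: Fpow_def)
      then have "finite {i \<in> Field k. inf c1 (g {i}) \<noteq> bot}"
        by (auto intro: finite_subset[of _ "{}"])
      with zero have "c1 \<in> D" by (simp add: D_def)
      with c1 show ?thesis by blast
    next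
      case True
      then obtain S where S: "P S" and max: "\<And>T. P T \<Longrightarrow> card T \<le> card S"
        using ex_has_greatest_nat[of P _ card n] bound by (metis less_imp_le)
      define d where "d = inf c1 (g S)"
      have fS: "S \<in> Fpow (Field k)" "finite S" using S by (auto simp: P_def Fpow_def)
      \<comment> \<open>If \<open>d\<close> meets \<open>g T\<close>, multiplicativity makes
        \<open>c1\<close> meet \<open>g (S \<union> T)\<close>, and the maximal size of
        \<open>S\<close> leaves no room for new elements. So \<open>d\<close> misses
        \<open>g T\<close> unless \<open>T \<subseteq> S\<close>, in which case
        \<open>d \<le> g S \<le> g T\<close>.\<close>
      have sub: "T \<subseteq> S" if "T \<in> Fpow (Field k)" "inf d (g T) \<noteq> bot" for T
      proof -
        have "S \<union> T \<in> Fpow (Field k)" using fS that by (auto simp: Fpow_def)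
        moreover have "g (S \<union> T) = inf (g S) (g T)"
          using g fS that by (auto simp: multiplicative_def)
        ultimately have "P (S \<union> T)" using that(2) by (simp add: P_def d_def inf_assoc)
        then have "card (S \<union> T) \<le> card S" by (rule max)
        moreover have "finite (S \<union> T)" using fS that by (auto simp: Fpow_def)
        ultimately show ?thesis by (metis Un_upper1 Un_upper2 card_seteq)
      qed
      have "d \<in> D"
        unfolding D_def
      proof (intro CollectI conjI ballI)
        fix T assume T: "T \<in> Fpow (Field k)"
        show "d \<le> g T \<or> inf d (g T) = bot"
          using sub[OF T] multiplicative_mono[OF g T fS(1)] by (auto simp: d_def le_infI2)
      next
        have "{i \<in> Field k. inf d (g {i}) \<noteq> bot} \<subseteq> S"
          using sub[of "{_}"] by (auto simp: Fpow_def)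
        then show "finite {i \<in> Field k. inf d (g {i}) \<noteq> bot}"
          using fS(2) by (rule finite_subset)
      qed
      moreover have "d \<noteq> bot" "d \<le> c" using S c1 by (auto simp: d_def P_def le_infI1)
      ultimately show ?thesis by blast
    qed
  qed
  then obtain B where B: "maximal_antichain B" "B \<subseteq> D"
    using maximal_antichain_in_dense[of D] by blast
  show thesis
  proof (rule that[OF B(1)])
    show "based_on (g S) B" if "S \<in> Fpow (Field k)" for S
      using B(2) that unfolding based_on_def D_def by blast
    show "finite {i \<in> Field k. inf b (g {i}) \<noteq> bot}" if "b \<in> B" for b
      using B(2) that unfolding D_def by blast
  qed
qed

lemma incomplete_good_imp_benda:
  fixes lam :: "'l rel" and U :: "'b::{boolean_algebra,complete_lattice} set"
  assumes U: "ultrafilter U" and inc: "aleph1_incomplete U" and good: "good lam U"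
  shows "benda lam U"
  unfolding benda_def
proof (intro allI impI)
  fix k :: "'l rel" and f :: "'l set \<Rightarrow> 'b" and A :: "'l \<Rightarrow> 'b set"
  assume H: "Card_order k \<and> k <o lam \<and> f \<in> Fpow (Field k) \<rightarrow> U \<and>
        (\<forall>i\<in>Field k. maximal_antichain (A i)) \<and>
        (\<forall>S\<in>Fpow (Field k). based_on (f S) (meet_antichains S A))"
  obtain x :: "nat \<Rightarrow> 'b"
    where x: "range x \<subseteq> U" "antimono x" "(INF n. x n) = bot"
    using aleph1_incomplete_decreasing[OF U inc] .
  \<comment> \<open>Goodness applies to monotonic functions only; the meet over the finitely many
    subsets of \<open>S\<close> makes \<open>f\<close> monotonic while staying in
    \<open>U\<close>.\<close>
  define f' where "f' S = inf (INF T\<in>Pow S. f T) (x (card S))" for S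
  have "f' S \<in> U" if "S \<in> Fpow (Field k)" for S
  proof -
    have "f T \<in> U" if "T \<subseteq> S" for T
      using H \<open>S \<in> Fpow (Field k)\<close> that by (auto simp: Fpow_def intro: finite_subset elim!: PiE)
    with that have "(INF T\<in>Pow S. f T) \<in> U"
      by (intro ultrafilter_Inf_finite[OF U]) (auto simp: Fpow_def)
    with x(1) U show ?thesis by (auto simp: f'_def ultrafilter_def)
  qed
  moreover have "monotonic k f'"
    unfolding monotonic_def f'_def
    by (intro ballI impI inf_mono INF_superset_mono antimonoD[OF x(2)] card_mono)
      (auto simp: Fpow_def)
  ultimately obtain g where g: "g \<in> Fpow (Field k) \<rightarrow> U" "multiplicative k g"
    and le: "\<forall>S\<in>Fpow (Field k). g S \<le> f' S"
    using good[unfolded good_def, rule_format, of k f'] H by blast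
  have "g S \<le> x (card S)" if "S \<in> Fpow (Field k)" for S
    using bspec[OF le that] by (simp add: f'_def)
  then obtain B where B: "maximal_antichain B"
    "\<And>S. S \<in> Fpow (Field k) \<Longrightarrow> based_on (g S) B"
    "\<And>b. b \<in> B \<Longrightarrow> finite {i \<in> Field k. inf b (g {i}) \<noteq> bot}"
    using multiplicative_based_on_antichain[OF g(2) x(2,3)] by blast
  have "g S \<le> f S" if "S \<in> Fpow (Field k)" for S
    using bspec[OF le that] by (auto simp: f'_def le_INF_iff)
  with g B show "\<exists>g B. g \<in> Fpow (Field k) \<rightarrow> U \<and> multiplicative k g \<and> maximal_antichain B \<and>
           (\<forall>S\<in>Fpow (Field k). based_on (g S) (meet_antichain B (meet_antichains S A))) \<and>
           (\<forall>b\<in>B. finite {i \<in> Field k. inf b (g {i}) \<noteq> bot}) \<and>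
           (\<forall>S\<in>Fpow (Field k). g S \<le> f S)"
    \<comment> \<open>Being based on \<open>B\<close> passes to every refinement of
      \<open>B\<close>.\<close>
    by (intro exI[of _ g] exI[of _ B]) (auto intro: based_on_meet_antichain)
qed

section \<open>From the Benda property to incompleteness and goodness\<close>

lemma benda_locally_finite:
  fixes lam k :: "'l rel" and U :: "'b::{boolean_algebra,complete_lattice} set"
  assumes U: "ultrafilter U" and benda: "benda lam U" and k: "Card_order k" "k <o lam"
  obtains h B where "\<And>i. i \<in> Field k \<Longrightarrow> h i \<in> U" "maximal_antichain B"
    "\<And>b. b \<in> B \<Longrightarrow> finite {i \<in> Field k. inf b (h i) \<noteq> bot}"
proof -
  have "\<forall>i\<in>Field k. maximal_antichain {top::'b}"
    using maximal_antichain_top[OF ultrafilter_top_neq_bot(1)[OF U]] by blast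
  moreover have "\<forall>S\<in>Fpow (Field k). based_on (top::'b) (meet_antichains S (\<lambda>_. {top}))"
    by (simp add: based_on_def)
  moreover have "(\<lambda>_. top) \<in> Fpow (Field k) \<rightarrow> U"
    using ultrafilter_top_neq_bot(2)[OF U] by blast
  ultimately obtain g B where "g \<in> Fpow (Field k) \<rightarrow> U" "maximal_antichain B"
    "\<forall>b\<in>B. finite {i \<in> Field k. inf b (g {i}) \<noteq> bot}"
    using benda[unfolded benda_def, rule_format, of k "\<lambda>_. top" "\<lambda>_. {top}"] k by blast
  then show thesis by (intro that[of "\<lambda>i. g {i}" B]) (auto simp: Fpow_def)
qed

text \<open>The cardinal has to live on the same type as \<open>lam\<close>, so the order of the
  natural numbers is replaced by the cardinality of an injective image of them in
  \<open>'l\<close>.\<close>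

lemma infinite_card_below:
  fixes lam :: "'l rel"
  assumes "Card_order lam" "natLeq <o lam"
  obtains k :: "'l rel" where "Card_order k" "k <o lam" "infinite (Field k)" "countable (Field k)"
proof -
  have "natLeq \<le>o |Field lam|"
    using assms card_of_Field_ordIso ordIso_symmetric ordLeq_ordIso_trans ordLess_imp_ordLeq
    by blast
  then have "infinite (Field lam)" using infinite_iff_natLeq_ordLeq by blast
  then obtain e :: "nat \<Rightarrow> 'l" where e: "inj e"
    using infinite_countable_subset by blast
  have "|range e| =o |UNIV :: nat set|"
    using e card_of_ordIsoI inj_on_imp_bij_betw ordIso_symmetric by blast
  then have "|range e| <o lam"
    using card_of_nat assms(2) ordIso_ordLess_trans ordIso_transitive by blast
  moreover have "infinite (range e)" using e range_inj_infinite by blast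
  ultimately show thesis
    using that[OF card_of_Card_order[of "range e"]] by (simp add: Field_card_of)
qed

lemma benda_imp_incomplete:
  fixes lam :: "'l rel" and U :: "'b::{boolean_algebra,complete_lattice} set"
  assumes "Card_order lam" "natLeq <o lam" and U: "ultrafilter U" and benda: "benda lam U"
  shows "aleph1_incomplete U"
proof -
  obtain k :: "'l rel"
    where k: "Card_order k" "k <o lam" "infinite (Field k)" "countable (Field k)"
    using infinite_card_below[OF assms(1,2)] .
  obtain h B where h: "\<And>i. i \<in> Field k \<Longrightarrow> h i \<in> U" and B: "maximal_antichain B"
    and fin: "\<And>b. b \<in> B \<Longrightarrow> finite {i \<in> Field k. inf b (h i) \<noteq> bot}"
    using benda_locally_finite[OF U benda k(1,2)] by blast
  \<comment> \<open>A nonzero meet would meet some \<open>b\<close> in \<open>B\<close>, and this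
    \<open>b\<close> would then meet all of the infinitely many \<open>h i\<close>.\<close>
  have "(INF i\<in>Field k. h i) = bot"
  proof (rule ccontr)
    assume "(INF i\<in>Field k. h i) \<noteq> bot"
    then obtain b where b: "b \<in> B" "inf (INF i\<in>Field k. h i) b \<noteq> bot"
      using maximal_antichain_meets[OF B] by blast
    have "inf b (h i) \<noteq> bot" if "i \<in> Field k" for i
    proof -
      have "inf (INF i\<in>Field k. h i) b \<le> inf b (h i)"
        using that by (simp add: INF_lower le_infI1)
      with b(2) show ?thesis by (metis bot.extremum_unique)
    qed
    then have "{i \<in> Field k. inf b (h i) \<noteq> bot} = Field k" by blast
    with fin[OF b(1)] k(3) show False by simp
  qed
  then have "Inf (h ` Field k) \<notin> U" using U by (simp add: ultrafilter_def)
  then show ?thesis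
    using h k(4) unfolding aleph1_incomplete_def by (intro exI[of _ "h ` Field k"]) auto
qed

lemma benda_imp_good:
  fixes lam :: "'l rel" and U :: "'b::{boolean_algebra,complete_lattice} set"
  assumes U: "ultrafilter U" and benda: "benda lam U"
  shows "good lam U"
  unfolding good_def
proof (intro allI impI)
  fix k :: "'l rel" and f :: "'l set \<Rightarrow> 'b"
  assume H: "Card_order k \<and> k <o lam \<and> f \<in> Fpow (Field k) \<rightarrow> U \<and> monotonic k f"
  then have k: "Card_order k" "k <o lam" by auto
  obtain h B where h: "\<And>i. i \<in> Field k \<Longrightarrow> h i \<in> U" and B: "maximal_antichain B"
    and fin: "\<And>b. b \<in> B \<Longrightarrow> finite {i \<in> Field k. inf b (h i) \<noteq> bot}"
    using benda_locally_finite[OF U benda k] by blast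
  \<comment> \<open>At \<open>{}\<close> the meet of the antichains is \<open>{top}\<close>, so a
    value in \<open>U\<close> based on it can only be \<open>top\<close>. Elsewhere the factors
    \<open>h i\<close> make \<open>f2\<close> vanish locally for all but finitely many
    \<open>S\<close>.\<close>
  define f2 where "f2 S = (if S = {} then top else inf (f S) (INF i\<in>S. h i))" for S
  define D where "D = {c. \<forall>S\<in>Fpow (Field k). c \<le> f2 S \<or> inf c (f2 S) = bot}"
  have "\<exists>d\<in>D. d \<noteq> bot \<and> d \<le> c" if "c \<noteq> bot" for c
  proof -
    obtain b where b: "b \<in> B" "inf c b \<noteq> bot"
      using maximal_antichain_meets[OF B \<open>c \<noteq> bot\<close>] .
    let ?I = "{i \<in> Field k. inf b (h i) \<noteq> bot}"
    \<comment> \<open>Below \<open>b\<close>, only subsets of the finite set \<open>?I\<close> can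
      give a nonzero \<open>f2 S\<close>, so deciding these finitely many values decides all of
      them.\<close>
    obtain d where d: "d \<le> inf c b" "d \<noteq> bot" "\<forall>y\<in>f2 ` Pow ?I. d \<le> y \<or> inf d y = bot"
      using finite_decide[of "f2 ` Pow ?I" "inf c b"] fin[OF b(1)] b(2) by blast
    have "d \<le> f2 S \<or> inf d (f2 S) = bot" if "S \<in> Fpow (Field k)" for S
    proof (cases "S \<subseteq> ?I")
      case True
      with d(3) show ?thesis by blast
    next
      case False
      with that obtain i where i: "i \<in> S" "inf b (h i) = bot" by (auto simp: Fpow_def)
      then have "f2 S \<le> h i" by (auto simp: f2_def intro: le_infI2 INF_lower)
      with d(1) have "inf d (f2 S) \<le> inf b (h i)" by (intro inf_mono) auto
      with i show ?thesis by (simp add: bot.extremum_unique)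
    qed
    with d show ?thesis by (auto simp: D_def)
  qed
  then obtain C where C: "maximal_antichain C" "C \<subseteq> D"
    using maximal_antichain_in_dense[of D] by blast
  have based: "based_on (f2 S) (meet_antichains S (\<lambda>_. C))" if "S \<in> Fpow (Field k)" for S
  proof (cases "S = {}")
    case True
    then show ?thesis by (simp add: f2_def based_on_def)
  next
    case False
    have "based_on (f2 S) C" using C(2) that by (auto simp: based_on_def D_def)
    with False show ?thesis by (rule based_on_meet_antichains_const[rotated])
  qed
  have "f2 S \<in> U" if "S \<in> Fpow (Field k)" for S
  proof -
    have "(INF i\<in>S. h i) \<in> U"
      using that h by (intro ultrafilter_Inf_finite[OF U]) (auto simp: Fpow_def)
    moreover have "f S \<in> U" using H that by blast
    ultimately show ?thesis using U by (auto simp: f2_def ultrafilter_def)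
  qed
  then obtain g where g: "g \<in> Fpow (Field k) \<rightarrow> U" "multiplicative k g"
    "\<forall>S\<in>Fpow (Field k). g S \<le> f2 S"
    \<comment> \<open>Every index receives the same antichain \<open>C\<close>.\<close>
    using benda[unfolded benda_def, rule_format, of k f2 "\<lambda>_. C"] k C(1) based by blast
  \<comment> \<open>The Benda property forces \<open>f2 {} = top\<close>, so the bound at \<open>{}\<close> is restored afterwards.\<close>
  define g' where "g' S = inf (g S) (f {})" for S
  have "f {} \<in> U" using H by (auto simp: Fpow_def)
  then have "g' \<in> Fpow (Field k) \<rightarrow> U"
    using g(1) U unfolding g'_def ultrafilter_def by blast
  moreover have "multiplicative k g'"
    using g(2) by (auto simp: multiplicative_def g'_def inf_assoc inf_left_commute)
  moreover have "g' S \<le> f S" if "S \<in> Fpow (Field k)" for S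
  proof (cases "S = {}")
    case True
    then show ?thesis by (simp add: g'_def)
  next
    case False
    with bspec[OF g(3) that] have "g S \<le> inf (f S) (INF i\<in>S. h i)" by (simp add: f2_def)
    then show ?thesis unfolding g'_def by (meson inf_le1 le_infI1 order_trans)
  qed
  ultimately show "\<exists>g. g \<in> Fpow (Field k) \<rightarrow> U \<and> multiplicative k g \<and>
             (\<forall>S\<in>Fpow (Field k). g S \<le> f S)" by blast
qed

theorem theorem2p14:
  fixes lam :: "'l rel"
    and U :: "'b::{boolean_algebra,complete_lattice} set"
  assumes "Card_order lam" and "natLeq <o lam"
    and "ultrafilter U"
  shows "benda lam U \<longleftrightarrow> aleph1_incomplete U \<and> good lam U"
  using benda_imp_incomplete[OF assms] benda_imp_good[OF assms(3)]
    incomplete_good_imp_benda[OF assms(3)] by blast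

end
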